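(* Let $G$ be a finite graph with $M(G)>0$, and let $\lambda=\lambda(G)$. Then there exists a constant $C=C(G)>0$ such that, for infinitely many positive integers $k$, the tensor power $G^{\otimes k}$ contains a regular subgraph $F_k$ of degree $d_k$ satisfying $$\lambda^k k^{-C}\le d_k\le \lambda^k .$$ Moreover, $M(F_k)\le M(G)^k$.
   Context: Graphs are finite and simple, with nonempty vertex set. $M(G):=2e(G)$ where $e(G)$ is the number of edges, and $\lambda(G)$ is the spectral radius of the adjacency matrix of $G$. The $k$-th tensor power $G^{\otimes k}$ has vertex set $V(G)^k$, and $(u_1,\dots,u_k)$, $(v_1,\dots,v_k)$ are adjacent if and only if $u_iv_i\in E(G)$ for every $i\in\{1,\dots,k\}$. Subgraphs are not required to be induced or spanning. *)

theory Defs
  imports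
    "Graph_Theory.Digraph_Component"
    "Jordan_Normal_Form.Spectral_Radius"
begin

text \<open>
  An undirected graph is represented as a symmetric, loop-free set of ordered pairs
  (\<^locale>\<open>pair_graph\<close>); every undirected edge \<open>uv\<close> contributes the two arcs \<open>(u, v)\<close> and
  \<open>(v, u)\<close>. The null graph, which \<^locale>\<open>pair_graph\<close> allows, is excluded.
\<close>

definition simple_graph :: "'a pair_pre_digraph \<Rightarrow> bool" where
  "simple_graph G \<longleftrightarrow> pair_graph G \<and> pverts G \<noteq> {}"

definition edges :: "'a pair_pre_digraph \<Rightarrow> 'a set set" where
  "edges G = {{u, v} | u v. (u, v) \<in> parcs G}"

definition edge_mass :: "'a pair_pre_digraph \<Rightarrow> nat" where
  "edge_mass G = 2 * card (edges G)"

definition adjacency_mat :: "'a pair_pre_digraph \<Rightarrow> 'a list \<Rightarrow> complex mat" where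
  "adjacency_mat G vs = mat (length vs) (length vs)
     (\<lambda>(i, j). if (vs ! i, vs ! j) \<in> parcs G then 1 else 0)"

text \<open>
  The choice of the vertex enumeration is immaterial: another one conjugates the adjacency
  matrix by a permutation matrix, which preserves the spectrum.
\<close>

definition graph_spectral_radius :: "'a pair_pre_digraph \<Rightarrow> real" where
  "graph_spectral_radius G =
     spectral_radius (adjacency_mat G (SOME vs. distinct vs \<and> set vs = pverts G))"

text \<open>
  The tuples in \<open>V(G)\<^sup>k\<close> are lists of length \<open>k\<close>. For \<open>k = 0\<close> the definition yields a single
  vertex with a loop, so it is meant for \<open>k > 0\<close> only.
\<close>

definition tensor_power :: "'a pair_pre_digraph \<Rightarrow> nat \<Rightarrow> 'a list pair_pre_digraph" where
  "tensor_power G k =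
     (let V = {us. length us = k \<and> set us \<subseteq> pverts G} in
      \<lparr> pverts = V,
        parcs = {(us, vs). us \<in> V \<and> vs \<in> V \<and> (\<forall>i<k. (us ! i, vs ! i) \<in> parcs G)} \<rparr>)"

text \<open>In a symmetric digraph the out-degree of a vertex is its number of neighbours.\<close>

definition regular_of_degree :: "'a pair_pre_digraph \<Rightarrow> nat \<Rightarrow> bool" where
  "regular_of_degree G d \<longleftrightarrow> (\<forall>v \<in> pverts G. out_degree (with_proj G) v = d)"

end

theory Submission
  imports Defs "HOL-Combinatorics.Permutations"
begin

text \<open>
  Split the arcs of \<open>G\<^sup>\<otimes>\<^sup>k\<close> by joint type: the arc \<open>(w, y)\<close> has as its type the multiset \<open>M\<close> of the
  coordinate arcs \<open>(w\<^sub>i, y\<^sub>i)\<close>. The arcs of type \<open>M\<close> lead from the words with letter multiset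
  \<open>fst M\<close> to those with letter multiset \<open>snd M\<close>, and permuting coordinates shows that every source
  has the same number \<open>D(M)\<close> of out-neighbours and every target the same number \<open>D(M\<^sup>T)\<close> of
  in-neighbours, where \<open>M\<^sup>T\<close> reverses all arcs. Hence the type-\<open>M\<close> part of a
  quadratic form at a unit vector \<open>x\<^sup>\<otimes>\<^sup>k\<close>, \<open>x \<ge> 0\<close>, is at most \<open>sqrt (D(M) D(M\<^sup>T))\<close>. Taking
  for \<open>x\<close> the moduli of an extremal eigenvector, the whole form is at least \<open>\<lambda>\<^sup>k\<close>, and since there
  are only polynomially many types, some \<open>M\<close> has \<open>D(M) D(M\<^sup>T) \<ge> \<lambda>\<^sup>2\<^sup>k / poly(k)\<close>. The type
  \<open>M + M\<^sup>T\<close> in \<open>G\<^sup>\<otimes>\<^sup>2\<^sup>k\<close> is symmetric, so its arcs form a regular graph, and by concatenation its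
  degree is at least \<open>D(M) D(M\<^sup>T)\<close>. The upper bound on the degree compares the walks in the regular
  subgraph with the tuples of walks in \<open>G\<close>.
\<close>

section \<open>Joint types\<close>

lemma listset_conv: "listset As = {xs. list_all2 (\<in>) xs As}"
proof (induction As)
  case (Cons A As)
  then show ?case by (auto simp: set_Cons_def list_all2_Cons2)
qed simp

text \<open>The distributive law, in a form that serves twice: with equal sets it expands a power of
  the quadratic form, with neighbourhoods it factorises sums over adjacent tuples.\<close>

lemma sum_prod_list_listset:
  fixes f :: "'a \<Rightarrow> 'b::comm_semiring_1"
  shows "(\<Sum>xs\<in>listset As. prod_list (map f xs)) = prod_list (map (sum f) As)"
proof (induction As)
  case (Cons A As)
  have eq: "listset (A # As) = (\<lambda>(x, xs). x # xs) ` (A \<times> listset As)"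
    by (auto simp: set_Cons_def)
  have inj: "inj_on (\<lambda>(x, xs). x # xs) (A \<times> listset As)"
    by (auto simp: inj_on_def)
  show ?case
    unfolding eq sum.reindex[OF inj]
    by (simp add: Cons.IH[symmetric] sum_product sum.cartesian_product case_prod_unfold)
qed simp

lemma sum_prod_list_lists:
  fixes f :: "'a \<Rightarrow> 'b::comm_semiring_1"
  shows "(\<Sum>xs\<in>{xs. length xs = k \<and> set xs \<subseteq> A}. prod_list (map f xs)) = sum f A ^ k"
proof -
  have "{xs. length xs = k \<and> set xs \<subseteq> A} = listset (replicate k A)"
    by (auto simp: listset_conv list_all2_conv_all_nth set_conv_nth)
  then show ?thesis
    by (simp add: sum_prod_list_listset)
qed

section \<open>Degrees of a joint type\<close>

lemma finite_mset_class: "finite {xs. mset xs = M}"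
  by (rule finite_subset[OF _ finite_lists_length_eq[of "set_mset M" "size M"]]) auto

text \<open>Since \<open>zip\<close> truncates, the length condition is what makes \<open>y\<close>
  recoverable from \<open>zip w y\<close>.\<close>

definition joint_nbrs :: "('a \<times> 'b) multiset \<Rightarrow> 'a list \<Rightarrow> 'b list set" where
  "joint_nbrs M w = {y. length y = length w \<and> mset (zip w y) = M}"

text \<open>The source word is read off an arbitrary arrangement of \<open>M\<close>;
  \<open>card_joint_nbrs\<close> shows that every other source word gives the same count.\<close>

definition type_degree :: "('a \<times> 'b) multiset \<Rightarrow> nat" where
  "type_degree M = card (joint_nbrs M (map fst (SOME ps. mset ps = M)))"

lemma finite_joint_nbrs: "finite (joint_nbrs M w)"
proof (rule finite_subset)
  show "joint_nbrs M w \<subseteq> map snd ` {ps. mset ps = M}"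
  proof
    fix y assume y: "y \<in> joint_nbrs M w"
    then have "y = map snd (zip w y)" by (simp add: joint_nbrs_def)
    with y show "y \<in> map snd ` {ps. mset ps = M}"
      unfolding joint_nbrs_def by blast
  qed
qed (simp add: finite_mset_class)

text \<open>A permutation carrying \<open>w\<close> to \<open>w'\<close>, applied to both ends of an
  arc, only reorders the coordinate pairs, so it embeds one neighbourhood into the other. Exchanging
  \<open>w\<close> and \<open>w'\<close> later gives equality.\<close>

lemma card_joint_nbrs_le:
  assumes "mset w = mset w'"
  shows "card (joint_nbrs M w) \<le> card (joint_nbrs M w')"
proof -
  obtain p where p: "p permutes {..<length w}" "permute_list p w = w'"
    using mset_eq_permutation[OF assms[symmetric]] by metis
  have len: "length w = length w'" using assms by (rule mset_eq_length)
  have sub: "permute_list p ` joint_nbrs M w \<subseteq> joint_nbrs M w'"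
  proof safe
    fix y assume y: "y \<in> joint_nbrs M w"
    then have l: "length w = length y" by (simp add: joint_nbrs_def)
    have "mset (zip w' (permute_list p y)) = mset (permute_list p (zip w y))"
      using permute_list_zip[OF p(1) refl l] p(2) by simp
    also have "\<dots> = mset (zip w y)"
      by (rule mset_permute_list) (use p(1) l in simp)
    finally show "permute_list p y \<in> joint_nbrs M w'"
      using y len by (simp add: joint_nbrs_def)
  qed
  have inj: "inj_on (permute_list p) (joint_nbrs M w)"
  proof (rule inj_onI)
    fix y z assume "y \<in> joint_nbrs M w" "z \<in> joint_nbrs M w"
      and eq: "permute_list p y = permute_list p z"
    then have l: "length y = length w" "length z = length w" by (auto simp: joint_nbrs_def)
    show "y = z"
    proof (rule nth_equalityI)
      fix i assume "i < length y"
      then obtain j where "j < length w" "p j = i"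
        using p(1) l by (metis lessThan_iff permutes_inv permutes_in_image permutes_inverses(1))
      then show "y ! i = z ! i"
        using arg_cong[OF eq, of "\<lambda>xs. xs ! j"] l p(1) by (simp add: permute_list_nth)
    qed (use l in simp)
  qed
  show ?thesis by (rule card_inj_on_le[OF inj sub finite_joint_nbrs])
qed

lemma card_joint_nbrs:
  assumes "mset w = image_mset fst M"
  shows "card (joint_nbrs M w) = type_degree M"
proof -
  have "mset (SOME ps. mset ps = M) = M"
    by (rule someI_ex) (rule ex_mset)
  then have "mset w = mset (map fst (SOME ps. mset ps = M))"
    using assms by simp
  then show ?thesis
    unfolding type_degree_def by (intro antisym card_joint_nbrs_le) simp_all
qed

text \<open>The arrangements of \<open>M\<close> are the zipped arcs of type \<open>M\<close>; they
  are counted here by their sources.\<close>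

lemma card_mset_class_eq:
  "card {ps. mset ps = M} = card {w. mset w = image_mset fst M} * type_degree M"
proof -
  let ?S = "SIGMA w:{w. mset w = image_mset fst M}. joint_nbrs M w"
  have "bij_betw (\<lambda>(w, y). zip w y) ?S {ps. mset ps = M}"
    by (rule bij_betwI[where g = "\<lambda>ps. (map fst ps, map snd ps)"])
       (auto simp: joint_nbrs_def zip_map_fst_snd)
  then have "card {ps. mset ps = M} = card ?S"
    by (metis bij_betw_same_card)
  also have "\<dots> = (\<Sum>w\<in>{w. mset w = image_mset fst M}. card (joint_nbrs M w))"
    by (rule card_SigmaI) (auto simp: finite_mset_class finite_joint_nbrs)
  also have "\<dots> = (\<Sum>w\<in>{w. mset w = image_mset fst M}. type_degree M)"
    by (intro sum.cong) (auto simp: card_joint_nbrs)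
  finally show ?thesis by simp
qed

text \<open>Reversing arcs is a bijection, so the same arcs can also be counted by their
  targets.\<close>

lemma card_mset_class_swap:
  "card {ps. mset ps = image_mset prod.swap M} = card {ps. mset ps = M}"
proof -
  have "bij_betw (map prod.swap) {ps. mset ps = M} {ps. mset ps = image_mset prod.swap M}"
    by (rule bij_betwI[where g = "map prod.swap"])
       (auto simp: comp_def multiset.map_comp)
  then show ?thesis by (metis bij_betw_same_card)
qed

text \<open>Neighbours of two source words concatenate to neighbours of the concatenated word, and
  the known lengths make this injective.\<close>

lemma type_degree_add:
  "type_degree M * type_degree M' \<le> type_degree (M + M')"
proof -
  obtain ps ps' where ps: "mset ps = M" "mset ps' = M'" using ex_mset by metis
  let ?w = "map fst ps" and ?w' = "map fst ps'"
  have "inj_on (\<lambda>(y, y'). y @ y') (joint_nbrs M ?w \<times> joint_nbrs M' ?w')"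
    by (auto simp: inj_on_def joint_nbrs_def)
  moreover have "(\<lambda>(y, y'). y @ y') ` (joint_nbrs M ?w \<times> joint_nbrs M' ?w')
      \<subseteq> joint_nbrs (M + M') (?w @ ?w')"
    by (auto simp: joint_nbrs_def)
  ultimately have "card (joint_nbrs M ?w \<times> joint_nbrs M' ?w') \<le> card (joint_nbrs (M + M') (?w @ ?w'))"
    by (rule card_inj_on_le[OF _ _ finite_joint_nbrs])
  then show ?thesis
    using ps by (simp add: card_cartesian_product card_joint_nbrs)
qed

section \<open>The weight of one type, and a heaviest type\<close>

lemma type_class_mass_le_1:
  fixes x :: "'a \<Rightarrow> real"
  assumes "finite V" "(\<Sum>u\<in>V. (x u)\<^sup>2) = 1" "set_mset R \<subseteq> V"
  shows "real (card {w. mset w = R}) * (prod_mset (image_mset x R))\<^sup>2 \<le> 1"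
proof -
  have pl: "prod_list (map (\<lambda>u. (x u)\<^sup>2) w) = (prod_mset (image_mset x (mset w)))\<^sup>2" for w
    by (induction w) (auto simp: power_mult_distrib)
  have "real (card {w. mset w = R}) * (prod_mset (image_mset x R))\<^sup>2
      = (\<Sum>w\<in>{w. mset w = R}. prod_list (map (\<lambda>u. (x u)\<^sup>2) w))"
    by (simp add: pl)
  \<comment> \<open>The squares of \<open>x\<close> are a probability distribution on
    \<open>V\<close>; the words of the class are part of its product space, whose total mass is
    1.\<close>
  also have "\<dots> \<le> (\<Sum>w\<in>{w. length w = size R \<and> set w \<subseteq> V}. prod_list (map (\<lambda>u. (x u)\<^sup>2) w))"
    by (rule sum_mono2) (use assms in \<open>auto simp: pl intro: finite_subset[OF _ finite_lists_length_eq[of V "size R"]]\<close>)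
  also have "\<dots> = 1"
    using assms by (simp add: sum_prod_list_lists)
  finally show ?thesis .
qed

text \<open>Double counting: all arcs of type \<open>M\<close> have the same weight, the product of
  the source value \<open>a\<close> and the target value \<open>b\<close>. Their number
  \<open>p\<close> is both \<open>r\<close> times the out-degree and \<open>c\<close> times the
  in-degree, so the square of the total weight splits into the two degrees times the masses of the
  source and target classes, each at most 1.\<close>

lemma mset_class_weight_le:
  fixes x :: "'a \<Rightarrow> real"
  assumes "finite V" "(\<Sum>u\<in>V. (x u)\<^sup>2) = 1" "set_mset M \<subseteq> V \<times> V"
  shows "real (card {ps. mset ps = M}) * prod_mset (image_mset (\<lambda>(u, v). x u * x v) M)
    \<le> sqrt (real (type_degree M * type_degree (image_mset prod.swap M)))"
proof (rule real_le_rsqrt)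
  let ?T = "image_mset prod.swap M"
  define p r c where "p = real (card {ps. mset ps = M})"
    and "r = real (card {w. mset w = image_mset fst M})"
    and "c = real (card {w. mset w = image_mset snd M})"
  define a b where "a = prod_mset (image_mset x (image_mset fst M))"
    and "b = prod_mset (image_mset x (image_mset snd M))"
  have p1: "p = r * real (type_degree M)"
    unfolding p_def r_def by (simp add: card_mset_class_eq)
  \<comment> \<open>The sources of the reversed type are the targets of \<open>M\<close>.\<close>
  have p2: "p = c * real (type_degree ?T)"
    unfolding p_def c_def card_mset_class_swap[of M, symmetric]
    by (subst card_mset_class_eq) (simp add: multiset.map_comp comp_def)
  have ra: "r * a\<^sup>2 \<le> 1" and cb: "c * b\<^sup>2 \<le> 1"
    unfolding r_def c_def a_def b_def
    by (rule type_class_mass_le_1[OF assms(1,2)]; use assms(3) in auto)+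
  have "prod_mset (image_mset (\<lambda>(u, v). x u * x v) M) = a * b"
    unfolding a_def b_def by (induction M) (auto simp: ac_simps)
  then have "(p * prod_mset (image_mset (\<lambda>(u, v). x u * x v) M))\<^sup>2 = p * p * (a\<^sup>2 * b\<^sup>2)"
    by (simp add: power2_eq_square ac_simps)
  also have "\<dots> = (r * real (type_degree M)) * (c * real (type_degree ?T)) * (a\<^sup>2 * b\<^sup>2)"
    using p1 p2 by simp
  also have "\<dots> = real (type_degree M * type_degree ?T) * ((r * a\<^sup>2) * (c * b\<^sup>2))"
    by (simp add: ac_simps)
  also have "\<dots> \<le> real (type_degree M * type_degree ?T) * (1 * 1)"
    by (intro mult_left_mono mult_mono ra cb) (auto simp: r_def c_def)
  finally show "(real (card {ps. mset ps = M}) * prod_mset (image_mset (\<lambda>(u, v). x u * x v) M))\<^sup>2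
    \<le> real (type_degree M * type_degree ?T)"
    by (simp add: p_def)
qed

text \<open>A type is determined by the multiplicities of the arcs in \<open>E\<close>, each between
  0 and \<open>k\<close>. For fixed \<open>E\<close> the bound is polynomial in
  \<open>k\<close>.\<close>

lemma msets_of_size:
  assumes "finite E"
  shows "finite {M. size M = k \<and> set_mset M \<subseteq> E}"
    and "card {M. size M = k \<and> set_mset M \<subseteq> E} \<le> (k + 1) ^ card E"
proof -
  let ?S = "{M. size M = k \<and> set_mset M \<subseteq> E}"
  have "inj_on (\<lambda>M. restrict (count M) E) ?S"
  proof (rule inj_onI)
    fix M N assume "M \<in> ?S" "N \<in> ?S" and eq: "restrict (count M) E = restrict (count N) E"
    show "M = N"
    proof (rule multiset_eqI)
      fix e show "count M e = count N e"
      proof (cases "e \<in> E")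
        case True
        then show ?thesis using fun_cong[OF eq, of e] by simp
      next
        case False
        then have "e \<notin># M" "e \<notin># N" using \<open>M \<in> ?S\<close> \<open>N \<in> ?S\<close> by auto
        then show ?thesis by (simp add: not_in_iff)
      qed
    qed
  qed
  moreover have "(\<lambda>M. restrict (count M) E) ` ?S \<subseteq> E \<rightarrow>\<^sub>E {..k}"
    by (auto intro: count_le_size)
  moreover have "finite (E \<rightarrow>\<^sub>E {..k})" using assms by (simp add: finite_PiE)
  ultimately show "finite ?S" "card ?S \<le> (k + 1) ^ card E"
    using card_inj_on_le[of "\<lambda>M. restrict (count M) E" ?S "E \<rightarrow>\<^sub>E {..k}"] assms
      inj_on_finite[of "\<lambda>M. restrict (count M) E" ?S "E \<rightarrow>\<^sub>E {..k}"]
    by (auto simp: card_PiE)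
qed

text \<open>The \<open>k\<close>-th power of the form is expanded over lists of arcs and grouped by
  type; a type with the largest bound reaches at least the average.\<close>

lemma exists_heavy_type:
  fixes x :: "'a \<Rightarrow> real"
  assumes "finite V" "(\<Sum>u\<in>V. (x u)\<^sup>2) = 1" "E \<subseteq> V \<times> V" "E \<noteq> {}"
    and "\<And>u. 0 \<le> x u" "0 \<le> l" "l \<le> (\<Sum>(u, v)\<in>E. x u * x v)"
  shows "\<exists>M. size M = k \<and> set_mset M \<subseteq> E \<and>
    l ^ (2 * k) \<le> real ((k + 1) ^ (2 * card E))
      * real (type_degree M * type_degree (image_mset prod.swap M))"
proof -
  let ?S = "{M. size M = k \<and> set_mset M \<subseteq> E}"
  let ?L = "{ps. length ps = k \<and> set ps \<subseteq> E}"
  let ?g = "\<lambda>M. sqrt (real (type_degree M * type_degree (image_mset prod.swap M)))"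
  let ?f = "\<lambda>(u, v). x u * x v"
  have E: "finite E" using assms(1,3) finite_subset by blast
  note S = msets_of_size[OF E, of k]
  obtain e where "e \<in> E" using assms(4) by auto
  \<comment> \<open>\<open>Max\<close> below needs some type to exist: \<open>k\<close> copies of
    one arc.\<close>
  then have ne: "?S \<noteq> {}" by (auto intro!: exI[of _ "replicate_mset k e"] split: if_splits)
  have "l ^ k \<le> (\<Sum>e\<in>E. ?f e) ^ k"
    using assms by (intro power_mono) auto
  also have "\<dots> = (\<Sum>ps\<in>?L. prod_list (map ?f ps))"
    by (simp add: sum_prod_list_lists)
  also have "\<dots> = (\<Sum>M\<in>?S. \<Sum>ps\<in>{ps \<in> ?L. mset ps = M}. prod_list (map ?f ps))"
    by (rule sum.group[symmetric]) (use E S in \<open>auto intro: finite_subset[OF _ finite_lists_length_eq[of E k]]\<close>)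
  also have "\<dots> \<le> (\<Sum>M\<in>?S. ?g M)"
  proof (rule sum_mono)
    fix M assume M: "M \<in> ?S"
    then have "{ps \<in> ?L. mset ps = M} = {ps. mset ps = M}" by auto
    then have "(\<Sum>ps\<in>{ps \<in> ?L. mset ps = M}. prod_list (map ?f ps))
        = real (card {ps. mset ps = M}) * prod_mset (image_mset ?f M)"
      by (simp flip: prod_mset_prod_list)
    also have "\<dots> \<le> ?g M"
      by (rule mset_class_weight_le[OF assms(1,2)]) (use M assms(3) in auto)
    finally show "(\<Sum>ps\<in>{ps \<in> ?L. mset ps = M}. prod_list (map ?f ps)) \<le> ?g M" .
  qed
  finally have le: "l ^ k \<le> (\<Sum>M\<in>?S. ?g M)" .
  have "Max (?g ` ?S) \<in> ?g ` ?S"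
    using S(1) ne by (intro Max_in) simp_all
  then obtain M where M: "Max (?g ` ?S) = ?g M" "M \<in> ?S" by (rule imageE)
  have "(\<Sum>M\<in>?S. ?g M) \<le> real (card ?S) * ?g M"
  proof (rule sum_bounded_above)
    fix N assume "N \<in> ?S"
    then show "?g N \<le> ?g M"
      unfolding M(1)[symmetric] by (intro Max_ge finite_imageI S(1) imageI)
  qed
  also have "\<dots> \<le> real ((k + 1) ^ card E) * ?g M"
    using S by (intro mult_right_mono) (simp_all only: of_nat_le_iff, simp)
  finally have "l ^ k \<le> real ((k + 1) ^ card E) * ?g M" using le by simp
  \<comment> \<open>Squaring removes the root from \<open>?g\<close> and doubles both
    exponents.\<close>
  then have "(l ^ k)\<^sup>2 \<le> (real ((k + 1) ^ card E) * ?g M)\<^sup>2"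
    using assms by (intro power_mono) auto
  also have "\<dots> = real ((k + 1) ^ (2 * card E)) * (?g M)\<^sup>2"
    by (simp add: power_mult_distrib power_even_eq)
  also have "(?g M)\<^sup>2 = real (type_degree M * type_degree (image_mset prod.swap M))"
    by (rule real_sqrt_pow2) simp
  finally show ?thesis using M(2) by (intro exI[of _ M]) (simp add: power_even_eq)
qed

section \<open>Spectral radius and walks\<close>

lemma sum_over_enum:
  assumes "distinct vs" "set vs = V"
  shows "(\<Sum>u\<in>V. f u) = (\<Sum>i<length vs. f (vs ! i))"
  using sum.reindex_bij_betw[OF bij_betw_nth[OF assms(1) refl assms(2)[symmetric]], of f] by simp

text \<open>By the triangle inequality the moduli \<open>y\<close> of an eigenvector satisfy the
  eigenvalue equation as an inequality in every row. Pairing with \<open>y\<close> and normalising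
  gives the bound.\<close>

lemma eigenvalue_le_rayleigh:
  assumes vs: "distinct vs" "set vs = pverts G" and E: "parcs G \<subseteq> pverts G \<times> pverts G"
    and ev: "eigenvalue (adjacency_mat G vs) ev"
  shows "\<exists>x. (\<forall>u. 0 \<le> x u) \<and> (\<Sum>u\<in>pverts G. (x u)\<^sup>2) = 1 \<and>
    cmod ev \<le> (\<Sum>(u, v)\<in>parcs G. x u * x v)"
proof -
  let ?A = "adjacency_mat G vs" and ?n = "length vs" and ?V = "pverts G" and ?E = "parcs G"
  have finV: "finite ?V" using vs by (metis finite_set)
  have A: "?A \<in> carrier_mat ?n ?n" by (simp add: adjacency_mat_def)
  obtain w where w: "w \<in> carrier_vec ?n" "w \<noteq> 0\<^sub>v ?n" "?A *\<^sub>v w = ev \<cdot>\<^sub>v w"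
    using ev A unfolding eigenvalue_def eigenvector_def by auto
  \<comment> \<open>Vertices are translated back to positions in \<open>vs\<close>. Outside the
    vertex set the value is unspecified, but still a modulus and hence nonnegative.\<close>
  define y where "y u = cmod (w $ the_inv_into {..<?n} ((!) vs) u)" for u
  have inj: "inj_on ((!) vs) {..<?n}" by (rule inj_on_nth) (use vs in auto)
  have y_nth: "y (vs ! i) = cmod (w $ i)" if "i < ?n" for i
    using the_inv_into_f_f[OF inj] that by (simp add: y_def)
  have y0: "0 \<le> y u" for u by (simp add: y_def)
  have row: "cmod ev * y u \<le> (\<Sum>v\<in>?V. if (u, v) \<in> ?E then y v else 0)" if "u \<in> ?V" for u
  proof -
    have "u \<in> set vs" using that vs(2) by simp
    then obtain i where i: "i < ?n" "u = vs ! i" by (metis in_set_conv_nth)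
    have "cmod ev * y u = cmod ((?A *\<^sub>v w) $ i)"
      unfolding w(3) using i w(1) by (simp add: y_nth norm_mult)
    also have "(?A *\<^sub>v w) $ i = (\<Sum>j<?n. (if (u, vs ! j) \<in> ?E then 1 else 0) * w $ j)"
      using i w(1) by (simp add: adjacency_mat_def scalar_prod_def atLeast0LessThan)
    also have "cmod \<dots> \<le> (\<Sum>j<?n. cmod ((if (u, vs ! j) \<in> ?E then 1 else 0) * w $ j))"
      by (rule norm_sum)
    also have "\<dots> = (\<Sum>j<?n. if (u, vs ! j) \<in> ?E then y (vs ! j) else 0)"
      by (intro sum.cong) (auto simp: y_nth)
    also have "\<dots> = (\<Sum>v\<in>?V. if (u, v) \<in> ?E then y v else 0)"
      by (rule sum_over_enum[OF vs, symmetric])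
    finally show ?thesis .
  qed
  define S where "S = (\<Sum>u\<in>?V. (y u)\<^sup>2)"
  have "\<exists>i<?n. w $ i \<noteq> 0"
    using w(1,2) by (metis carrier_vecD eq_vecI index_zero_vec(1) index_zero_vec(2))
  then obtain i where i: "i < ?n" "w $ i \<noteq> 0" by blast
  have "0 < (y (vs ! i))\<^sup>2" using i by (simp add: y_nth)
  also have "\<dots> \<le> S" unfolding S_def
  proof (rule member_le_sum)
    show "vs ! i \<in> ?V" using nth_mem[OF i(1)] vs(2) by simp
  qed (simp_all add: finV)
  finally have S: "S > 0" .
  have "cmod ev * S = (\<Sum>u\<in>?V. y u * (cmod ev * y u))"
    by (simp add: S_def sum_distrib_left power2_eq_square ac_simps)
  also have "\<dots> \<le> (\<Sum>u\<in>?V. y u * (\<Sum>v\<in>?V. if (u, v) \<in> ?E then y v else 0))"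
    by (intro sum_mono mult_left_mono row y0)
  also have "\<dots> = (\<Sum>p\<in>?V \<times> ?V. if p \<in> ?E then y (fst p) * y (snd p) else 0)"
    by (auto simp: sum_distrib_left sum.cartesian_product intro!: sum.cong)
  also have "\<dots> = (\<Sum>p\<in>(?V \<times> ?V) \<inter> ?E. y (fst p) * y (snd p))"
    using finV by (simp add: sum.inter_restrict)
  also have "(?V \<times> ?V) \<inter> ?E = ?E" using E by auto
  finally have le: "cmod ev * S \<le> (\<Sum>p\<in>?E. y (fst p) * y (snd p))" .
  show ?thesis
  proof (intro exI[of _ "\<lambda>u. y u / sqrt S"] conjI allI)
    show "0 \<le> y u / sqrt S" for u using S by (simp add: y0)
    show "(\<Sum>u\<in>?V. (y u / sqrt S)\<^sup>2) = 1"
      using S by (simp add: power_divide S_def[symmetric] flip: sum_divide_distrib)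
    have "(\<Sum>(u, v)\<in>?E. y u / sqrt S * (y v / sqrt S)) = (\<Sum>p\<in>?E. y (fst p) * y (snd p)) / S"
      using S by (simp add: sum_divide_distrib case_prod_unfold)
    with le S show "cmod ev \<le> (\<Sum>(u, v)\<in>?E. y u / sqrt S * (y v / sqrt S))"
      by (simp add: pos_le_divide_eq)
  qed
qed

section \<open>Walk counts and the upper bound on the degree\<close>

definition nbr_sum :: "('a \<times> 'a) set \<Rightarrow> ('a \<Rightarrow> real) \<Rightarrow> 'a \<Rightarrow> real" where
  "nbr_sum E f u = sum f (E `` {u})"

lemma nbr_sum_nonneg: "(\<And>u. 0 \<le> f u) \<Longrightarrow> 0 \<le> (nbr_sum E ^^ n) f u"
  by (induction n arbitrary: u) (auto simp: nbr_sum_def intro: sum_nonneg)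

text \<open>The \<open>n\<close>-th iterate of \<open>nbr_sum\<close>, applied to the constant 1,
  counts the walks of length \<open>n\<close> from a vertex. Dividing the adjacency matrix by \<mu>
  brings its spectral radius below 1, so all powers of the quotient \<open>B\<close> have uniformly
  bounded entries.\<close>

lemma walk_count_le:
  assumes vs: "distinct vs" "set vs = pverts G" "vs \<noteq> []" and E: "parcs G \<subseteq> pverts G \<times> pverts G"
    and mu: "spectral_radius (adjacency_mat G vs) < \<mu>"
  shows "\<exists>c. \<forall>n. \<forall>u\<in>pverts G. (nbr_sum (parcs G) ^^ n) (\<lambda>_. 1) u \<le> c * \<mu> ^ n"
proof -
  let ?A = "adjacency_mat G vs" and ?n = "length vs" and ?V = "pverts G" and ?E = "parcs G"
  let ?T = "nbr_sum ?E"
  have A: "?A \<in> carrier_mat ?n ?n" by (simp add: adjacency_mat_def)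
  have n: "?n > 0" using vs by simp
  have "spectral_radius ?A \<ge> 0" using spectral_radius_mem_max(1)[OF A n] by auto
  with mu have mu0: "\<mu> > 0" by simp
  define B where "B = mat ?n ?n (\<lambda>(i, j). (if (vs ! i, vs ! j) \<in> ?E then 1 / complex_of_real \<mu> else 0))"
  have B: "B \<in> carrier_mat ?n ?n" by (simp add: B_def)
  have AB: "?A = complex_of_real \<mu> \<cdot>\<^sub>m B"
    using mu0 by (intro eq_matI) (auto simp: adjacency_mat_def B_def)
  obtain e where e: "spectral_radius B = cmod e" "eigenvalue B e"
    using spectral_radius_mem_max(1)[OF B n] by (auto simp: spectrum_def)
  then obtain w where w: "w \<in> carrier_vec ?n" "w \<noteq> 0\<^sub>v ?n" "B *\<^sub>v w = e \<cdot>\<^sub>v w"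
    using B unfolding eigenvalue_def eigenvector_def by auto
  \<comment> \<open>An eigenvector of \<open>B\<close> is one of the adjacency matrix, with the
    eigenvalue scaled by \<mu>; this transfers the bound on the spectral radius.\<close>
  have "?A *\<^sub>v w = (\<mu> * e) \<cdot>\<^sub>v w"
  proof (rule eq_vecI)
    fix i assume "i < dim_vec ((\<mu> * e) \<cdot>\<^sub>v w)"
    then have i: "i < ?n" using w(1) by simp
    have "(?A *\<^sub>v w) $ i = \<mu> * ((B *\<^sub>v w) $ i)"
      unfolding AB using i B w(1) by simp
    then show "(?A *\<^sub>v w) $ i = ((\<mu> * e) \<cdot>\<^sub>v w) $ i"
      unfolding w(3) using i w(1) by simp
  qed (use A w in simp)
  then have "eigenvalue ?A (\<mu> * e)"
    using A w unfolding eigenvalue_def eigenvector_def by auto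
  then have "cmod (\<mu> * e) \<le> spectral_radius ?A"
    using spectral_radius_mem_max(2)[OF A n] by (auto simp: spectrum_def)
  moreover have "cmod (\<mu> * e) = \<mu> * cmod e" using mu0 by (simp add: norm_mult)
  ultimately have "\<mu> * cmod e < \<mu> * 1" using mu by linarith
  then have "spectral_radius B < 1" unfolding e(1) by (rule mult_less_cancel_left_pos[OF mu0, THEN iffD1])
  from spectral_radius_jnf_norm_bound_less_1_upper_triangular[OF B this]
  obtain c where c: "\<And>k. norm_bound (B ^\<^sub>m k) c" by blast
  have T_nth: "?T f (vs ! i) = (\<Sum>j<?n. if (vs ! i, vs ! j) \<in> ?E then f (vs ! j) else 0)" for f i
  proof -
    have "?T f (vs ! i) = (\<Sum>v\<in>?V \<inter> ?E `` {vs ! i}. f v)"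
      unfolding nbr_sum_def using E by (intro sum.cong) auto
    also have "\<dots> = (\<Sum>v\<in>?V. if v \<in> ?E `` {vs ! i} then f v else 0)"
      by (rule sum.inter_restrict) (metis vs(2) finite_set)
    finally show ?thesis by (simp add: sum_over_enum[OF vs(1,2)])
  qed
  have pow: "complex_of_real ((?T ^^ k) f (vs ! i)) = \<mu> ^ k * (\<Sum>j<?n. (B ^\<^sub>m k) $$ (i, j) * f (vs ! j))"
    if i: "i < ?n" for k f i
  proof (induction k arbitrary: f)
    case 0
    have "(\<Sum>j<?n. (B ^\<^sub>m 0) $$ (i, j) * f (vs ! j))
        = (\<Sum>j<?n. if j = i then complex_of_real (f (vs ! j)) else 0)"
      using i B by (intro sum.cong) auto
    also have "\<dots> = f (vs ! i)" using i by simp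
    finally show ?case by simp
  next
    case (Suc k)
    have Bk: "B ^\<^sub>m k \<in> carrier_mat ?n ?n" using B by simp
    have "(\<Sum>j<?n. (B ^\<^sub>m Suc k) $$ (i, j) * f (vs ! j))
        = (\<Sum>j<?n. (\<Sum>l<?n. (B ^\<^sub>m k) $$ (i, l) * B $$ (l, j)) * f (vs ! j))"
      using i B Bk by (intro sum.cong) (auto simp: scalar_prod_def atLeast0LessThan)
    also have "\<dots> = (\<Sum>l<?n. (B ^\<^sub>m k) $$ (i, l) * (\<Sum>j<?n. B $$ (l, j) * f (vs ! j)))"
      unfolding sum_distrib_left sum_distrib_right by (subst sum.swap) (simp add: ac_simps)
    also have "\<dots> = (\<Sum>l<?n. (B ^\<^sub>m k) $$ (i, l) * (?T f (vs ! l) / \<mu>))"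
      unfolding T_nth B_def
      by (intro sum.cong arg_cong2[where f = "(*)"] refl)
        (auto simp: sum_divide_distrib intro!: sum.cong)
    also have "\<dots> = (\<Sum>l<?n. (B ^\<^sub>m k) $$ (i, l) * ?T f (vs ! l)) / \<mu>"
      by (simp add: sum_divide_distrib)
    finally show ?case
      \<comment> \<open>The extra step is absorbed into \<open>f\<close>, which is why the induction
        keeps \<open>f\<close> arbitrary.\<close>
      unfolding funpow_Suc_right comp_def Suc.IH using mu0 by simp
  qed
  have "(?T ^^ k) (\<lambda>_. 1) u \<le> (real ?n * c) * \<mu> ^ k" if "u \<in> ?V" for k u
  proof -
    have "u \<in> set vs" using that vs(2) by simp
    then obtain i where i: "i < ?n" "u = vs ! i" by (metis in_set_conv_nth)
    have "(?T ^^ k) (\<lambda>_. 1) u \<le> cmod (complex_of_real ((?T ^^ k) (\<lambda>_. 1) u))"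
      by simp
    also have "\<dots> = \<mu> ^ k * cmod (\<Sum>j<?n. (B ^\<^sub>m k) $$ (i, j))"
      unfolding i(2) pow[OF i(1)] using mu0 by (simp add: norm_mult norm_power)
    also have "\<dots> \<le> \<mu> ^ k * (\<Sum>j<?n. c)"
      using c[of k] i(1) B mu0
      by (intro mult_left_mono sum_norm_le) (auto simp: norm_bound_def)
    finally show ?thesis by (simp add: ac_simps)
  qed
  then show ?thesis by blast
qed

text \<open>The left side counts the walks of length \<open>n\<close> from \<open>w\<close> in a
  regular graph on \<open>W\<close>. Each of them is, coordinate by coordinate, a tuple of walks
  along \<open>E\<close>, and the right side counts such tuples.\<close>

lemma degree_power_le_walk_counts:
  assumes E: "finite E"
    and W: "\<And>w. w \<in> W \<Longrightarrow> Nb w \<subseteq> W \<and> card (Nb w) = d \<and> (\<forall>y\<in>Nb w. list_all2 (\<lambda>u v. (u, v) \<in> E) w y)"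
    and "w \<in> W"
  shows "real d ^ n \<le> prod_list (map ((nbr_sum E ^^ n) (\<lambda>_. 1)) w)"
  using assms(3)
proof (induction n arbitrary: w)
  case 0
  have "prod_list (map (\<lambda>_. 1 :: real) w) = 1" by (induction w) auto
  then show ?case by simp
next
  case (Suc n)
  let ?h = "(nbr_sum E ^^ n) (\<lambda>_. 1)"
  let ?N = "listset (map (\<lambda>u. E `` {u}) w)"
  have h0: "0 \<le> ?h u" for u by (rule nbr_sum_nonneg) simp
  have fin: "finite (E `` {u})" for u using E by (simp add: finite_Image)
  have finN: "finite ?N"
  proof (induction w)
    case (Cons u w)
    have "listset (map (\<lambda>u. E `` {u}) (u # w))
        = (\<lambda>(x, xs). x # xs) ` (E `` {u} \<times> listset (map (\<lambda>u. E `` {u}) w))"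
      by (auto simp: set_Cons_def)
    then show ?case using Cons fin by (metis finite_cartesian_product finite_imageI)
  qed simp
  have sub: "Nb w \<subseteq> ?N"
  proof
    fix y assume "y \<in> Nb w"
    then have "list_all2 (\<lambda>u v. (u, v) \<in> E) w y" using W[OF Suc.prems] by blast
    then show "y \<in> ?N" by (auto simp: listset_conv list_all2_conv_all_nth)
  qed
  have "real d ^ Suc n = (\<Sum>y\<in>Nb w. real d ^ n)" using W[OF Suc.prems] by simp
  also have "\<dots> \<le> (\<Sum>y\<in>Nb w. prod_list (map ?h y))"
    using W[OF Suc.prems] by (intro sum_mono Suc.IH) auto
  \<comment> \<open>Passing from \<open>Nb w\<close> to all coordinatewise neighbours gives a
    product set, over which the sum factorises.\<close>
  also have "\<dots> \<le> (\<Sum>y\<in>?N. prod_list (map ?h y))"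
    by (rule sum_mono2[OF finN sub]) (auto intro!: prod_list_nonneg h0)
  also have "\<dots> = prod_list (map ((nbr_sum E ^^ Suc n) (\<lambda>_. 1)) w)"
    unfolding sum_prod_list_listset by (simp add: nbr_sum_def[abs_def] comp_def)
  finally show ?case .
qed

lemma prod_list_le_power:
  fixes f :: "'a \<Rightarrow> real"
  assumes "\<And>u. u \<in> set w \<Longrightarrow> 0 \<le> f u \<and> f u \<le> b"
  shows "prod_list (map f w) \<le> b ^ length w"
  using assms
proof (induction w)
  case (Cons u w)
  have u: "0 \<le> f u" "f u \<le> b" using Cons.prems by auto
  have "prod_list (map f w) \<le> b ^ length w" using Cons by simp
  moreover have "0 \<le> prod_list (map f w)" using Cons.prems by (auto intro!: prod_list_nonneg)
  ultimately show ?case using u by (simp add: mult_mono)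
qed simp

text \<open>The length \<open>k\<close> is fixed while the walks grow: if \<open>d\<close> exceeded
  the bound, the ratio of the two growth rates would eventually outrun the constant
  \<open>c ^ k\<close>.\<close>

lemma degree_le_power:
  assumes E: "finite E"
    and W: "\<And>w. w \<in> W \<Longrightarrow> Nb w \<subseteq> W \<and> card (Nb w) = d \<and> (\<forall>y\<in>Nb w. list_all2 (\<lambda>u v. (u, v) \<in> E) w y)"
    and w: "w \<in> W" "set w \<subseteq> V" "length w = k"
    and \<mu>: "\<mu> > 0" and c: "\<And>n u. u \<in> V \<Longrightarrow> (nbr_sum E ^^ n) (\<lambda>_. 1) u \<le> c * \<mu> ^ n"
  shows "real d \<le> \<mu> ^ k"
proof (rule ccontr)
  assume "\<not> ?thesis"
  then have "1 < real d / \<mu> ^ k" using \<mu> by simp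
  then obtain n where n: "c ^ k < (real d / \<mu> ^ k) ^ n" using real_arch_pow by blast
  have "real d ^ n \<le> prod_list (map ((nbr_sum E ^^ n) (\<lambda>_. 1)) w)"
    by (rule degree_power_le_walk_counts[OF E W w(1)])
  also have "\<dots> \<le> (c * \<mu> ^ n) ^ length w"
    by (rule prod_list_le_power) (use w c in \<open>auto intro: nbr_sum_nonneg\<close>)
  also have "\<dots> = c ^ k * (\<mu> ^ k) ^ n"
    by (simp add: w power_mult_distrib flip: power_mult) (simp add: mult.commute)
  finally show False using n \<mu> by (simp add: power_divide field_simps)
qed

section \<open>Regular subgraphs of tensor powers\<close>

lemma simple_graphD:
  assumes "simple_graph G"
  shows "finite (pverts G)" "finite (parcs G)" "parcs G \<subseteq> pverts G \<times> pverts G" "pverts G \<noteq> {}"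
    and "(u, v) \<in> parcs G \<Longrightarrow> (v, u) \<in> parcs G" "(u, u) \<notin> parcs G"
proof -
  interpret pair_graph G using assms by (simp add: simple_graph_def)
  show "finite (pverts G)" "finite (parcs G)" by (fact pair_finite_verts pair_finite_arcs)+
  show "parcs G \<subseteq> pverts G \<times> pverts G" using in_arcsD1 in_arcsD2 by auto
  show "pverts G \<noteq> {}" using assms by (simp add: simple_graph_def)
  show "(u, v) \<in> parcs G \<Longrightarrow> (v, u) \<in> parcs G" for u v
    using pair_sym_arcs by (simp add: symmetric_def sym_def)
  show "(u, u) \<notin> parcs G" using pair_no_loops by fastforce
qed

lemma simple_graphI:
  assumes "finite (pverts G)" "parcs G \<subseteq> pverts G \<times> pverts G" "pverts G \<noteq> {}"
    and sym: "\<And>u v. (u, v) \<in> parcs G \<Longrightarrow> (v, u) \<in> parcs G" and loop: "\<And>u. (u, u) \<notin> parcs G"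
  shows "simple_graph G"
  unfolding simple_graph_def
proof
  have "finite (parcs G)" using assms(1,2) finite_subset by blast
  then show "pair_graph G"
    using assms by unfold_locales (auto simp: symmetric_def sym_def)
qed (fact assms(3))

text \<open>Without loops every edge comes from exactly two arcs, which matches the factor 2 in
  \<open>edge_mass\<close>.\<close>

lemma edge_mass_eq_card_parcs:
  assumes "simple_graph G"
  shows "edge_mass G = card (parcs G)"
proof -
  note G = simple_graphD[OF assms]
  let ?e = "\<lambda>p. {fst p, snd p}"
  have "edges G = ?e ` parcs G" by (force simp: edges_def)
  then have "card (parcs G) = (\<Sum>e\<in>edges G. card {p \<in> parcs G. ?e p = e})"
    using sum.image_gen[OF G(2), of "\<lambda>_. 1 :: nat" ?e] by simp
  also have "\<dots> = (\<Sum>e\<in>edges G. 2)"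
  proof (rule sum.cong[OF refl])
    fix e assume "e \<in> edges G"
    then obtain u v where uv: "(u, v) \<in> parcs G" "e = {u, v}" by (auto simp: edges_def)
    then have "{p \<in> parcs G. ?e p = e} = {(u, v), (v, u)}"
      using G(5) by (auto simp: doubleton_eq_iff)
    moreover have "u \<noteq> v" using uv G(6) by auto
    ultimately show "card {p \<in> parcs G. ?e p = e} = 2" by simp
  qed
  finally show ?thesis by (simp add: edge_mass_def)
qed

lemma out_degree_with_proj: "out_degree (with_proj G) v = card (parcs G `` {v})"
proof -
  have "out_arcs (with_proj G) v = (\<lambda>u. (v, u)) ` (parcs G `` {v})"
    by (auto simp: out_arcs_def)
  then show ?thesis by (simp add: out_degree_def card_image inj_on_def)
qed

lemma tensor_power_subgraphD:
  assumes "subgraph (with_proj F) (with_proj (tensor_power G k))"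
  shows "w \<in> pverts F \<Longrightarrow> length w = k \<and> set w \<subseteq> pverts G"
    and "(w, y) \<in> parcs F \<Longrightarrow> length w = k \<and> list_all2 (\<lambda>u v. (u, v) \<in> parcs G) w y"
  using assms by (auto simp: subgraph_def tensor_power_def Let_def list_all2_conv_all_nth)

text \<open>Zipping the ends of an arc of \<open>F\<close> yields a list of \<open>k\<close> arcs of
  \<open>G\<close>, and equal lengths make this injective.\<close>

lemma edge_mass_le_power:
  assumes "simple_graph G" "simple_graph F"
    and sub: "subgraph (with_proj F) (with_proj (tensor_power G k))"
  shows "edge_mass F \<le> edge_mass G ^ k"
proof -
  note G = simple_graphD[OF assms(1)]
  let ?L = "{ps. set ps \<subseteq> parcs G \<and> length ps = k}"
  note D = tensor_power_subgraphD(2)[OF sub]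
  have "inj_on (\<lambda>(w, y). zip w y) (parcs F)"
  proof (rule inj_onI, clarify)
    fix w y w' y' assume a: "(w, y) \<in> parcs F" "(w', y') \<in> parcs F" "zip w y = zip w' y'"
    then have "length w = length y" "length w' = length y'"
      using D[of w y] D[of w' y'] by (auto dest: list_all2_lengthD)
    then show "w = w' \<and> y = y'" using a(3) by (metis map_fst_zip map_snd_zip)
  qed
  moreover have "(\<lambda>(w, y). zip w y) ` parcs F \<subseteq> ?L"
    using D by (fastforce simp: list_all2_iff)
  moreover have "finite ?L" using G by (simp add: finite_lists_length_eq)
  ultimately have "card (parcs F) \<le> card ?L" by (rule card_inj_on_le)
  then show ?thesis
    using assms G by (simp add: edge_mass_eq_card_parcs card_lists_length_eq)
qed

lemma graph_spectral_radius_enum: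
  assumes "simple_graph G"
  obtains vs where "distinct vs" "set vs = pverts G" "vs \<noteq> []"
    "graph_spectral_radius G = spectral_radius (adjacency_mat G vs)"
proof -
  define vs where "vs = (SOME vs. distinct vs \<and> set vs = pverts G)"
  have "distinct vs \<and> set vs = pverts G"
    unfolding vs_def by (rule someI_ex) (metis finite_distinct_list simple_graphD(1)[OF assms])
  moreover from this have "vs \<noteq> []" using simple_graphD(4)[OF assms] by auto
  moreover have "graph_spectral_radius G = spectral_radius (adjacency_mat G vs)"
    by (simp add: graph_spectral_radius_def vs_def)
  ultimately show ?thesis using that by blast
qed

lemma graph_spectral_radius_rayleigh:
  assumes "simple_graph G"
  shows "0 \<le> graph_spectral_radius G" (is ?nonneg)
    and "\<exists>x. (\<forall>u. 0 \<le> x u) \<and> (\<Sum>u\<in>pverts G. (x u)\<^sup>2) = 1 \<and>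
      graph_spectral_radius G \<le> (\<Sum>(u, v)\<in>parcs G. x u * x v)" (is ?ex)
proof -
  obtain vs where vs: "distinct vs" "set vs = pverts G" "vs \<noteq> []"
    "graph_spectral_radius G = spectral_radius (adjacency_mat G vs)"
    using graph_spectral_radius_enum[OF assms] .
  have "adjacency_mat G vs \<in> carrier_mat (length vs) (length vs)"
    by (simp add: adjacency_mat_def)
  from spectral_radius_mem_max(1)[OF this] vs(3)
  obtain ev where "eigenvalue (adjacency_mat G vs) ev" "graph_spectral_radius G = cmod ev"
    by (auto simp: spectrum_def vs(4))
  then show ?nonneg ?ex
    using eigenvalue_le_rayleigh[OF vs(1,2) simple_graphD(3)[OF assms]] by simp_all
qed

text \<open>Walk counts are controlled only at rates \<mu> strictly above the spectral radius.
  Taking \<open>k\<close>-th roots turns the passage to the limit into a comparison of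
  \<open>root k d\<close> with every such \<mu>.\<close>

lemma regular_degree_le_power:
  assumes G: "simple_graph G" and F: "simple_graph F" and k: "k > 0"
    and sub: "subgraph (with_proj F) (with_proj (tensor_power G k))"
    and reg: "regular_of_degree F d"
  shows "real d \<le> graph_spectral_radius G ^ k"
proof -
  let ?\<rho> = "graph_spectral_radius G"
  obtain vs where vs: "distinct vs" "set vs = pverts G" "vs \<noteq> []"
    "?\<rho> = spectral_radius (adjacency_mat G vs)"
    using graph_spectral_radius_enum[OF G] .
  obtain w where w: "w \<in> pverts F" using simple_graphD(4)[OF F] by blast
  have W: "parcs F `` {w} \<subseteq> pverts F \<and> card (parcs F `` {w}) = d \<and>
      (\<forall>y\<in>parcs F `` {w}. list_all2 (\<lambda>u v. (u, v) \<in> parcs G) w y)" if "w \<in> pverts F" for w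
    using that reg simple_graphD(3)[OF F] tensor_power_subgraphD(2)[OF sub]
    by (auto simp: regular_of_degree_def out_degree_with_proj)
  have "root k d \<le> \<mu>" if \<mu>: "?\<rho> < \<mu>" for \<mu>
  proof -
    have \<mu>0: "\<mu> > 0" using graph_spectral_radius_rayleigh(1)[OF G] \<mu> by simp
    obtain c where c: "\<And>n u. u \<in> pverts G \<Longrightarrow> (nbr_sum (parcs G) ^^ n) (\<lambda>_. 1) u \<le> c * \<mu> ^ n"
      using walk_count_le[OF vs(1-3) simple_graphD(3)[OF G]] \<mu> vs(4) by metis
    have "real d \<le> \<mu> ^ k"
      by (rule degree_le_power[where W = "pverts F" and Nb = "\<lambda>w. parcs F `` {w}",
            OF simple_graphD(2)[OF G] W w _ _ \<mu>0 c])
        (use tensor_power_subgraphD(1)[OF sub w] in auto)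
    then have "root k d \<le> root k (\<mu> ^ k)" using k by simp
    then show ?thesis using k \<mu>0 by (simp add: real_root_power_cancel)
  qed
  then have "root k d \<le> ?\<rho>" by (rule dense_ge)
  then have "root k d ^ k \<le> ?\<rho> ^ k" by (intro power_mono) (use k in auto)
  then show ?thesis using k by (simp add: real_root_pow_pos2)
qed

section \<open>The regular graph of a symmetric type\<close>

definition type_graph :: "('a \<times> 'a) multiset \<Rightarrow> 'a list pair_pre_digraph" where
  "type_graph M = \<lparr> pverts = {w. mset w = image_mset fst M},
     parcs = {(w, y). length w = length y \<and> mset (zip w y) = M} \<rparr>"

context
  fixes G :: "'a pair_pre_digraph" and M :: "('a \<times> 'a) multiset"
  assumes G: "simple_graph G" and M: "set_mset M \<subseteq> parcs G" "size M > 0"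
    and sym: "image_mset prod.swap M = M"
begin

text \<open>Reversing an arc swaps each coordinate pair, which leaves the symmetric \<open>M\<close>
  unchanged. Hence targets lie in the same letter class as sources, and \<open>type_graph\<close>
  needs only one vertex class.\<close>

lemma type_graph_arcD:
  assumes "length w = length y" "mset (zip w y) = M"
  shows "mset w = image_mset fst M" "mset y = image_mset fst M" "mset (zip y w) = M"
proof -
  show w: "mset w = image_mset fst M"
    unfolding assms(2)[symmetric] mset_map[symmetric] using assms(1) by simp
  have "zip y w = map prod.swap (zip w y)"
    using assms(1) by (intro nth_equalityI) auto
  then show yw: "mset (zip y w) = M" using assms(2) sym by simp
  show "mset y = image_mset fst M"
    unfolding yw[symmetric] mset_map[symmetric] using assms(1) by simp
qed

lemma simple_graph_type_graph: "simple_graph (type_graph M)"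
proof (rule simple_graphI)
  show "finite (pverts (type_graph M))" by (simp add: type_graph_def finite_mset_class)
  show "parcs (type_graph M) \<subseteq> pverts (type_graph M) \<times> pverts (type_graph M)"
    by (simp add: type_graph_def split_def subset_iff) (metis type_graph_arcD(1,2))
  show "pverts (type_graph M) \<noteq> {}" using ex_mset by (auto simp: type_graph_def)
  show "(y, w) \<in> parcs (type_graph M)" if "(w, y) \<in> parcs (type_graph M)" for w y
    using that type_graph_arcD(3)[of w y] by (simp add: type_graph_def)
  show "(w, w) \<notin> parcs (type_graph M)" for w
  proof
    assume "(w, w) \<in> parcs (type_graph M)"
    then have M': "mset (zip w w) = M" by (simp add: type_graph_def)
    \<comment> \<open>As \<open>M\<close> is nonempty, so is \<open>w\<close>; its first letter
      would carry a loop of \<open>G\<close>.\<close>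
    then obtain u where "(u, u) \<in># M" using M(2) by (cases w) fastforce+
    then show False using M(1) simple_graphD(6)[OF G] by auto
  qed
qed

lemma type_graph_subgraph:
  "subgraph (with_proj (type_graph M)) (with_proj (tensor_power G (size M)))"
proof -
  note V = simple_graphD(3)[OF G]
  have verts: "length w = size M \<and> set w \<subseteq> pverts G" if "mset w = image_mset fst M" for w
  proof -
    have "set w = fst ` set_mset M" using that by (metis set_image_mset set_mset_mset)
    moreover have "length w = size M" using that by (metis size_image_mset size_mset)
    ultimately show ?thesis using V M(1) by auto
  qed
  have arcs: "(w ! i, y ! i) \<in> parcs G"
    if "length w = length y" "mset (zip w y) = M" "i < size M" for w y i
  proof -
    have "i < length (zip w y)" using that by (metis size_mset)
    then have "(w ! i, y ! i) \<in> set (zip w y)" by (auto simp: set_zip)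
    then show ?thesis using that(2) M(1) by (metis set_mset_mset subsetD)
  qed
  have "wf_digraph (with_proj (tensor_power G (size M)))"
    by unfold_locales (auto simp: tensor_power_def Let_def)
  moreover have "wf_digraph (with_proj (type_graph M))"
    using simple_graphD(3)[OF simple_graph_type_graph] by unfold_locales auto
  moreover have "pverts (type_graph M) \<subseteq> pverts (tensor_power G (size M))"
    using verts by (auto simp: type_graph_def tensor_power_def Let_def)
  moreover have "parcs (type_graph M) \<subseteq> parcs (tensor_power G (size M))"
  proof
    fix p assume "p \<in> parcs (type_graph M)"
    then obtain w y where p: "p = (w, y)" "length w = length y" "mset (zip w y) = M"
      by (auto simp: type_graph_def)
    note verts[OF type_graph_arcD(1)[OF p(2,3)]] verts[OF type_graph_arcD(2)[OF p(2,3)]]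
    with arcs[OF p(2,3)] show "p \<in> parcs (tensor_power G (size M))"
      by (simp add: p(1) tensor_power_def)
  qed
  ultimately show ?thesis
    by (simp add: subgraph_def compatible_def)
qed

lemma regular_type_graph: "regular_of_degree (type_graph M) (type_degree M)"
  unfolding regular_of_degree_def
proof
  fix w assume "w \<in> pverts (type_graph M)"
  then have "mset w = image_mset fst M" by (simp add: type_graph_def)
  moreover have "parcs (type_graph M) `` {w} = joint_nbrs M w"
    by (auto simp: type_graph_def joint_nbrs_def)
  ultimately show "out_degree (with_proj (type_graph M)) w = type_degree M"
    by (simp add: out_degree_with_proj card_joint_nbrs)
qed

end

theorem theorem1p2:
  fixes G :: "'a pair_pre_digraph"
  assumes "simple_graph G"
    and "edge_mass G > 0"
  shows "\<exists>C::real. C > 0 \<and>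
    infinite {k::nat. k > 0 \<and>
      (\<exists>(F :: 'a list pair_pre_digraph) (d :: nat).
        simple_graph F \<and>
        subgraph (with_proj F) (with_proj (tensor_power G k)) \<and>
        regular_of_degree F d \<and>
        graph_spectral_radius G ^ k * real k powr (- C) \<le> real d \<and>
        real d \<le> graph_spectral_radius G ^ k \<and>
        edge_mass F \<le> edge_mass G ^ k)}"
proof -
  \<comment> \<open>\<open>?c\<close> becomes the exponent \<open>C\<close>: the number of types is
    at most a power with exponent \<open>card (parcs G)\<close>, and it enters squared.\<close>
  let ?\<rho> = "graph_spectral_radius G" and ?c = "2 * card (parcs G)"
  note G = simple_graphD[OF assms(1)]
  have card: "card (parcs G) > 0"
    using assms by (simp add: edge_mass_eq_card_parcs)
  then have ne: "parcs G \<noteq> {}" by auto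
  obtain x where x: "\<And>u. 0 \<le> x u" "(\<Sum>u\<in>pverts G. (x u)\<^sup>2) = 1"
    "?\<rho> \<le> (\<Sum>(u, v)\<in>parcs G. x u * x v)"
    using graph_spectral_radius_rayleigh(2)[OF assms(1)] by blast
  have main: "\<exists>(F :: 'a list pair_pre_digraph) (d :: nat).
        simple_graph F \<and>
        subgraph (with_proj F) (with_proj (tensor_power G (2 * j))) \<and>
        regular_of_degree F d \<and>
        ?\<rho> ^ (2 * j) * real (2 * j) powr (- real ?c) \<le> real d \<and>
        real d \<le> ?\<rho> ^ (2 * j) \<and>
        edge_mass F \<le> edge_mass G ^ (2 * j)" if j: "j > 0" for j
  proof -
    obtain M where M: "size M = j" "set_mset M \<subseteq> parcs G"
      and le: "?\<rho> ^ (2 * j) \<le> real ((j + 1) ^ ?c) * real (type_degree M * type_degree (image_mset prod.swap M))"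
      using exists_heavy_type[OF G(1) x(2) G(3) ne x(1) graph_spectral_radius_rayleigh(1)[OF assms(1)] x(3), of j]
      by blast
    \<comment> \<open>Adding the reversed type makes \<open>L\<close> symmetric and doubles the
      length, so the power used is \<open>2 * j\<close>.\<close>
    define L where "L = M + image_mset prod.swap M"
    have L: "set_mset L \<subseteq> parcs G" "size L = 2 * j" "size L > 0" "image_mset prod.swap L = L"
      using M G(5) j by (auto simp: L_def multiset.map_comp comp_def)
    note F = simple_graph_type_graph[OF assms(1) L(1,3,4)]
      type_graph_subgraph[OF assms(1) L(1,3,4), unfolded L(2)]
      regular_type_graph[OF assms(1) L(1,3,4)]
    have "?\<rho> ^ (2 * j) \<le> real ((j + 1) ^ ?c) * real (type_degree L)"
      using le type_degree_add[of M "image_mset prod.swap M"] unfolding L_def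
      by (meson mult_left_mono of_nat_0_le_iff of_nat_mono order_trans)
    \<comment> \<open>\<open>j + 1\<close> is at most \<open>2 * j\<close> for positive
      \<open>j\<close>, so the loss is a power of the exponent \<open>2 * j\<close> itself.\<close>
    also have "\<dots> \<le> real ((2 * j) ^ ?c) * real (type_degree L)"
      using j by (intro mult_right_mono of_nat_mono power_mono) auto
    finally have "?\<rho> ^ (2 * j) / real (2 * j) ^ ?c \<le> real (type_degree L)"
      using j by (simp add: pos_divide_le_eq ac_simps)
    then have "?\<rho> ^ (2 * j) * real (2 * j) powr (- real ?c) \<le> real (type_degree L)"
      using j by (simp only: powr_minus_divide powr_realpow) simp
    then show ?thesis
      using F j regular_degree_le_power[OF assms(1) F(1) _ F(2,3)]
        edge_mass_le_power[OF assms(1) F(1,2)] by auto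
  qed
  show ?thesis
  proof (intro exI[of _ "real ?c"] conjI)
    show "real ?c > 0" using card by simp
    show "infinite {k::nat. k > 0 \<and>
      (\<exists>(F :: 'a list pair_pre_digraph) (d :: nat).
        simple_graph F \<and>
        subgraph (with_proj F) (with_proj (tensor_power G k)) \<and>
        regular_of_degree F d \<and>
        ?\<rho> ^ k * real k powr (- real ?c) \<le> real d \<and>
        real d \<le> ?\<rho> ^ k \<and>
        edge_mass F \<le> edge_mass G ^ k)}" (is "infinite ?S")
      unfolding infinite_nat_iff_unbounded
    proof
      fix m
      \<comment> \<open>Every positive even exponent works, and this one exceeds
        \<open>m\<close>.\<close>
      have "2 * Suc m \<in> ?S" using main[of "Suc m"] by simp
      then show "\<exists>n>m. n \<in> ?S" by (intro exI[of _ "2 * Suc m"]) simp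
    qed
  qed
qed

end
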